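(* Let $(F; +, \cdot, <)$ be an ordered field such that $T = \mathrm{Th}(F;+,\cdot,<)$ is dp-small. Then every positive element of $F$ has an $n$th root in $F$ for every positive integer $n$.
   Context: For a complete theory $T$ in language $L$ with monster model $\mathcal{U}$ ($\mathcal{U}_y$ the $|y|$-tuples from $\mathcal{U}$): a partial type $\pi(x)$ is dp-small if there do not exist $L(\mathcal{U})$-formulas $\varphi_i(x)$ ($i<\omega$), an $L$-formula $\psi(x;y)$ and $b_j\in\mathcal{U}_y$ ($j<\omega$) such that for all $i_0,j_0<\omega$ the type $\pi(x)\cup\{\varphi_{i_0}(x),\psi(x;b_{j_0})\}\cup\{\neg\varphi_i(x): i\ne i_0\}\cup\{\neg\psi(x;b_j): j\neq j_0\}$ is consistent. $T$ is dp-small if $x=x$ is dp-small for $x$ a single variable. *)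

theory Defs
  imports Main
begin

datatype trm = Var nat | Add trm trm | Mul trm trm

datatype fm = Eq trm trm | Less trm trm | Neg fm | Conj fm fm | Ex nat fm

fun fv_trm :: "trm \<Rightarrow> nat set" where
  "fv_trm (Var v) = {v}"
| "fv_trm (Add s t) = fv_trm s \<union> fv_trm t"
| "fv_trm (Mul s t) = fv_trm s \<union> fv_trm t"

fun fv :: "fm \<Rightarrow> nat set" where
  "fv (Eq s t) = fv_trm s \<union> fv_trm t"
| "fv (Less s t) = fv_trm s \<union> fv_trm t"
| "fv (Neg p) = fv p"
| "fv (Conj p q) = fv p \<union> fv q"
| "fv (Ex v p) = fv p - {v}"

record 'b lstruct =
  univ :: "'b set"
  s_add :: "'b \<Rightarrow> 'b \<Rightarrow> 'b"
  s_mul :: "'b \<Rightarrow> 'b \<Rightarrow> 'b"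
  s_less :: "'b \<Rightarrow> 'b \<Rightarrow> bool"

definition wf_struct :: "'b lstruct \<Rightarrow> bool" where
  "wf_struct M \<longleftrightarrow> univ M \<noteq> {} \<and>
     (\<forall>a\<in>univ M. \<forall>b\<in>univ M. s_add M a b \<in> univ M \<and> s_mul M a b \<in> univ M)"

definition is_env :: "'b lstruct \<Rightarrow> (nat \<Rightarrow> 'b) \<Rightarrow> bool" where
  "is_env M e \<longleftrightarrow> (\<forall>v. e v \<in> univ M)"

fun tval :: "'b lstruct \<Rightarrow> (nat \<Rightarrow> 'b) \<Rightarrow> trm \<Rightarrow> 'b" where
  "tval M e (Var v) = e v"
| "tval M e (Add s t) = s_add M (tval M e s) (tval M e t)"
| "tval M e (Mul s t) = s_mul M (tval M e s) (tval M e t)"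

fun sat :: "'b lstruct \<Rightarrow> (nat \<Rightarrow> 'b) \<Rightarrow> fm \<Rightarrow> bool" where
  "sat M e (Eq s t) \<longleftrightarrow> tval M e s = tval M e t"
| "sat M e (Less s t) \<longleftrightarrow> s_less M (tval M e s) (tval M e t)"
| "sat M e (Neg p) \<longleftrightarrow> \<not> sat M e p"
| "sat M e (Conj p q) \<longleftrightarrow> sat M e p \<and> sat M e q"
| "sat M e (Ex v p) \<longleftrightarrow> (\<exists>a\<in>univ M. sat M (e(v := a)) p)"

definition elem_equiv :: "'b lstruct \<Rightarrow> 'c lstruct \<Rightarrow> bool" where
  "elem_equiv M N \<longleftrightarrow> (\<forall>p. fv p = {} \<longrightarrow>
     (\<forall>e e'. is_env M e \<longrightarrow> is_env N e' \<longrightarrow> (sat M e p \<longleftrightarrow> sat N e' p)))"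

definition ofield_struct :: "'a::linordered_field lstruct" where
  "ofield_struct = \<lparr>univ = UNIV, s_add = (+), s_mul = (*), s_less = (<)\<rparr>"

text \<open>Th(N) is dp-small (for a single variable x, which is variable 0).
  A failure of dp-smallness is witnessed in the monster model of Th(N); by saturation,
  downward Loewenheim-Skolem and elementary embedding into the monster model this is
  equivalent to a witness in some countable model M of Th(N), whose universe we take
  to be a subset of nat.  An L(M)-formula phi_i(x) is an L-formula phi i together with
  a parameter assignment c i (x = variable 0 is overwritten); psi(x;y) is an L-formula
  with x = variable 0 and the tuple b_j given by the assignment b j.\<close>
definition dp_small_theory :: "'c lstruct \<Rightarrow> bool" where
  "dp_small_theory N \<longleftrightarrow> \<not> (\<exists>M :: nat lstruct. wf_struct M \<and> elem_equiv M N \<and>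
     (\<exists>(phi :: nat \<Rightarrow> fm) (c :: nat \<Rightarrow> nat \<Rightarrow> nat) (psi :: fm) (b :: nat \<Rightarrow> nat \<Rightarrow> nat).
        (\<forall>i. is_env M (c i)) \<and> (\<forall>j. is_env M (b j)) \<and>
        (\<forall>i0 j0. \<exists>a\<in>univ M.
            sat M ((c i0)(0 := a)) (phi i0) \<and> sat M ((b j0)(0 := a)) psi \<and>
            (\<forall>i. i \<noteq> i0 \<longrightarrow> \<not> sat M ((c i)(0 := a)) (phi i)) \<and>
            (\<forall>j. j \<noteq> j0 \<longrightarrow> \<not> sat M ((b j)(0 := a)) psi))))"

end

theory Submission
  imports Defs "HOL-Library.Countable" "HOL-Library.Infinite_Set" "HOL-Library.Diagonal_Subsequence"
begin

text \<open>If \<open>g > 1\<close> has no \<open>m\<close>-th root, then for every \<open>N\<close> and \<open>j\<close> the interval between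
  \<open>g ^ (2 j m ^ N)\<close> and \<open>g ^ (2 (j + 1) m ^ N)\<close> contains, for each \<open>i < N\<close>, an element that is an
  \<open>m ^ i\<close>-th but not an \<open>m ^ (i + 1)\<close>-th power, namely \<open>g ^ (2 j m ^ N + m ^ i)\<close>. Letting
  \<open>N\<close> tend to infinity, a countable model realises all these configurations at once, with
  \<open>m\<close>-adic divisibility as the \<open>\<phi>\<^sub>i\<close> and the intervals as \<open>\<psi>(x; b\<^sub>j)\<close>. The model is a Skolem hull
  inside a reduced power along a subsequence on which the truth of each formula
  with Skolem term parameters stabilises, so that Los's theorem holds without an ultrafilter.\<close>

section \<open>Formulas and their free variables\<close>

text \<open>Countability of formulas lets the diagonal argument enumerate all of them and makes the
  Skolem hull codable in \<open>nat\<close>.\<close>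

instance trm :: countable
  by countable_datatype

instance fm :: countable
  by countable_datatype

lemma finite_fv_trm: "finite (fv_trm t)"
  by (induction t) auto

lemma finite_fv: "finite (fv p)"
  by (induction p) (auto simp: finite_fv_trm)

lemma tval_cong: "(\<And>v. v \<in> fv_trm t \<Longrightarrow> e v = e' v) \<Longrightarrow> tval M e t = tval M e' t"
  by (induction t) auto

lemma sat_cong: "(\<And>v. v \<in> fv p \<Longrightarrow> e v = e' v) \<Longrightarrow> sat M e p = sat M e' p"
proof (induction p arbitrary: e e')
  case (Eq s t)
  then show ?case using tval_cong[of s e e'] tval_cong[of t e e'] by auto
next
  case (Less s t)
  then show ?case using tval_cong[of s e e'] tval_cong[of t e e'] by auto
next
  case (Neg p)
  have "sat M e p = sat M e' p"
    by (rule Neg.IH) (use Neg.prems in auto)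
  then show ?case by simp
next
  case (Conj p q)
  have "sat M e p = sat M e' p" "sat M e q = sat M e' q"
    using Conj.prems by (auto intro!: Conj.IH)
  then show ?case by simp
next
  case (Ex v p)
  have "sat M (e(v := a)) p = sat M (e'(v := a)) p" for a
    using Ex.prems by (intro Ex.IH) auto
  then show ?case by simp
qed

lemma tval_in_univ: "wf_struct M \<Longrightarrow> is_env M e \<Longrightarrow> tval M e t \<in> univ M"
  by (induction t) (auto simp: wf_struct_def is_env_def)

section \<open>A countable reduced power\<close>

text \<open>By pigeonhole, every sequence has a subsequence on which one given \<open>P k\<close> is
  constant; diagonalisation then treats all countably many \<open>k\<close> at once.\<close>

lemma ex_subseq_deciding:
  fixes P :: "'k::countable \<Rightarrow> nat \<Rightarrow> bool"
  obtains r :: "nat \<Rightarrow> nat" where "strict_mono r"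
    and "\<And>k. (\<forall>\<^sub>F n in sequentially. P k (r n)) \<or> (\<forall>\<^sub>F n in sequentially. \<not> P k (r n))"
proof -
  define Q where "Q k s \<longleftrightarrow> (\<forall>n. P (from_nat k) (s n)) \<or> (\<forall>n. \<not> P (from_nat k) (s n))"
    for k and s :: "nat \<Rightarrow> nat"
  interpret subseqs Q
  proof
    fix k and s :: "nat \<Rightarrow> nat"
    show "\<exists>r. strict_mono r \<and> Q k (s \<circ> r)"
    proof (cases "infinite {n. P (from_nat k) (s n)}")
      case True
      show ?thesis
        using infinite_enumerate[OF True] by (auto simp: Q_def)
    next
      case False
      then have "infinite {n. \<not> P (from_nat k) (s n)}"
        by (simp add: Collect_neg_eq)
      from infinite_enumerate[OF this] show ?thesis
        by (auto simp: Q_def)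
    qed
  qed
  \<comment> \<open>From index \<open>Suc k\<close> on, \<open>diagseq\<close> runs inside the
    subsequence deciding the predicate with code \<open>k\<close>, and \<open>Q k\<close> passes to
    subsequences.\<close>
  have stable: "Q k (diagseq \<circ> ((+) (Suc k)))" for k
    by (rule diagseq_holds) (auto simp: Q_def)
  show thesis
  proof
    show "strict_mono diagseq" by (rule subseq_diagseq)
    fix k :: 'k
    have "eventually (\<lambda>n. R (diagseq n)) sequentially"
      if "\<forall>n. R (diagseq (Suc l + n))" for R l
      unfolding eventually_sequentially
      using that by (metis le_iff_add)
    with stable[of "to_nat k"]
    show "(\<forall>\<^sub>F n in sequentially. P k (diagseq n)) \<or> (\<forall>\<^sub>F n in sequentially. \<not> P k (diagseq n))"
      unfolding Q_def comp_def from_nat_to_nat by meson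
  qed
qed

section \<open>Skolem terms over prescribed sequences\<close>

datatype 'k skolem =
    Cst 'k
  | Plus "'k skolem" "'k skolem"
  | Times "'k skolem" "'k skolem"
  | Wit nat fm "'k skolem list"

instance skolem :: (countable) countable
  by countable_datatype

text \<open>Lists are padded by an arbitrary element to give assignments of all variables.\<close>
definition env_of :: "'c lstruct \<Rightarrow> 'c list \<Rightarrow> nat \<Rightarrow> 'c" where
  "env_of N xs v = (if v < length xs then xs ! v else (SOME a. a \<in> univ N))"

text \<open>\<open>Cst k\<close> names the sequence \<open>d k\<close>, and
  \<open>Wit v p ts\<close> names a witness for \<open>Ex v p\<close> at the parameters
  \<open>ts\<close>. The implication under \<open>SOME\<close> keeps the value in the universe even
  where no witness exists.\<close>

primrec skval :: "'c lstruct \<Rightarrow> ('k \<Rightarrow> nat \<Rightarrow> 'c) \<Rightarrow> nat \<Rightarrow> 'k skolem \<Rightarrow> 'c" where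
  "skval N d n (Cst k) = d k n"
| "skval N d n (Plus s t) = s_add N (skval N d n s) (skval N d n t)"
| "skval N d n (Times s t) = s_mul N (skval N d n s) (skval N d n t)"
| "skval N d n (Wit v p ts) = (SOME a. a \<in> univ N \<and>
     ((\<exists>x\<in>univ N. sat N ((env_of N (map (skval N d n) ts))(v := x)) p) \<longrightarrow>
       sat N ((env_of N (map (skval N d n) ts))(v := a)) p))"

lemma skval_Wit:
  assumes "univ N \<noteq> {}"
  shows "skval N d n (Wit v p ts) \<in> univ N"
    and "\<exists>x\<in>univ N. sat N ((env_of N (map (skval N d n) ts))(v := x)) p \<Longrightarrow>
      sat N ((env_of N (map (skval N d n) ts))(v := skval N d n (Wit v p ts))) p"
proof -
  let ?R = "\<lambda>a. a \<in> univ N \<and>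
     ((\<exists>x\<in>univ N. sat N ((env_of N (map (skval N d n) ts))(v := x)) p) \<longrightarrow>
       sat N ((env_of N (map (skval N d n) ts))(v := a)) p)"
  have "\<exists>a. ?R a" using assms by blast
  from someI_ex[OF this] have "?R (skval N d n (Wit v p ts))" by simp
  then show "skval N d n (Wit v p ts) \<in> univ N"
    and "\<exists>x\<in>univ N. sat N ((env_of N (map (skval N d n) ts))(v := x)) p \<Longrightarrow>
      sat N ((env_of N (map (skval N d n) ts))(v := skval N d n (Wit v p ts))) p"
    by blast+
qed

lemma skval_in_univ:
  assumes "wf_struct N" "\<And>k n. d k n \<in> univ N"
  shows "skval N d n t \<in> univ N"
proof -
  have "skval N d n (Wit v p ts) \<in> univ N" for v p ts
    using assms(1) skval_Wit(1) by (metis wf_struct_def)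
  then show ?thesis
    using assms by (induction t) (simp_all add: wf_struct_def del: skval.simps(4))
qed

text \<open>The assumption \<open>decided\<close> replaces an ultrafilter: along \<open>r\<close>,
  each formula at Skolem term parameters is eventually true or eventually false.\<close>

locale reduced_power =
  fixes N :: "'c lstruct" and d :: "'k::countable \<Rightarrow> nat \<Rightarrow> 'c" and r :: "nat \<Rightarrow> nat"
  assumes wf: "wf_struct N"
    and d_in: "d k n \<in> univ N"
    and mono_r: "strict_mono r"
    and decided: "(\<forall>\<^sub>F n in sequentially. sat N (env_of N (map (skval N d (r n)) ts)) p) \<or>
      (\<forall>\<^sub>F n in sequentially. \<not> sat N (env_of N (map (skval N d (r n)) ts)) p)"
begin

text \<open>The chosen \<open>s\<close> depends only on the class of \<open>t\<close> under eventual
  equality along \<open>r\<close>, so each class gets one code; the codes are natural numbers, as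
  \<open>dp_small_theory\<close> demands.\<close>

definition rep :: "'k skolem \<Rightarrow> nat" where
  "rep t = to_nat (SOME s. \<forall>\<^sub>F n in sequentially. skval N d (r n) s = skval N d (r n) t)"

definition val :: "nat \<Rightarrow> nat \<Rightarrow> 'c" where
  "val a n = skval N d (r n) (from_nat a)"

definition pow :: "nat lstruct" where
  "pow = \<lparr>univ = range rep,
    s_add = (\<lambda>a b. rep (Plus (from_nat a) (from_nat b))),
    s_mul = (\<lambda>a b. rep (Times (from_nat a) (from_nat b))),
    s_less = (\<lambda>a b. \<forall>\<^sub>F n in sequentially. s_less N (val a n) (val b n))\<rparr>"

lemma val_rep: "\<forall>\<^sub>F n in sequentially. val (rep t) n = skval N d (r n) t"
proof -
  have "\<forall>\<^sub>F n in sequentially.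
      skval N d (r n) (SOME s. \<forall>\<^sub>F n in sequentially. skval N d (r n) s = skval N d (r n) t)
      = skval N d (r n) t"
    by (rule someI[where x = t]) simp
  then show ?thesis by (simp add: val_def rep_def)
qed

lemma rep_eq_iff:
  "rep s = rep t \<longleftrightarrow> (\<forall>\<^sub>F n in sequentially. skval N d (r n) s = skval N d (r n) t)"
proof
  assume "rep s = rep t"
  then show "\<forall>\<^sub>F n in sequentially. skval N d (r n) s = skval N d (r n) t"
    using eventually_conj[OF val_rep[of s] val_rep[of t]] by (auto elim: eventually_mono)
next
  assume eq: "\<forall>\<^sub>F n in sequentially. skval N d (r n) s = skval N d (r n) t"
  have "(\<forall>\<^sub>F n in sequentially. skval N d (r n) u = skval N d (r n) s) \<longleftrightarrow>
      (\<forall>\<^sub>F n in sequentially. skval N d (r n) u = skval N d (r n) t)" for u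
    by (rule eventually_subst) (use eq in \<open>auto elim: eventually_mono\<close>)
  then show "rep s = rep t" by (simp add: rep_def)
qed

lemma eq_iff_val_eq:
  assumes "a \<in> univ pow" "b \<in> univ pow"
  shows "a = b \<longleftrightarrow> (\<forall>\<^sub>F n in sequentially. val a n = val b n)"
proof -
  obtain s t where st: "a = rep s" "b = rep t"
    using assms by (auto simp: pow_def)
  have "(\<forall>\<^sub>F n in sequentially. val a n = val b n) \<longleftrightarrow>
      (\<forall>\<^sub>F n in sequentially. skval N d (r n) s = skval N d (r n) t)"
    using eventually_conj[OF val_rep[of s] val_rep[of t]] unfolding st
    by (intro eventually_subst) (auto elim: eventually_mono)
  then show ?thesis by (simp add: st rep_eq_iff)
qed

lemma wf_pow: "wf_struct pow"
  by (simp add: wf_struct_def pow_def)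

lemma val_in: "val a n \<in> univ N"
  unfolding val_def by (rule skval_in_univ[OF wf d_in])

lemma tval_pow:
  "\<forall>\<^sub>F n in sequentially. val (tval pow e t) n = tval N (\<lambda>v. val (e v) n) t"
proof (induction t)
  case (Var v)
  show ?case by simp
next
  case (Add s t)
  show ?case
    using val_rep[of "Plus (from_nat (tval pow e s)) (from_nat (tval pow e t))"] Add
    by eventually_elim (simp add: pow_def flip: val_def)
next
  case (Mul s t)
  show ?case
    using val_rep[of "Times (from_nat (tval pow e s)) (from_nat (tval pow e t))"] Mul
    by eventually_elim (simp add: pow_def flip: val_def)
qed

text \<open>Only variables below a bound \<open>B\<close> of the free ones matter, so an assignment
  of codes becomes a finite list of terms, the form to which \<open>decided\<close> and
  \<open>Wit\<close> apply.\<close>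

lemma ex_skolem_list:
  obtains ts :: "'k skolem list" where
    "\<And>n v x. sat N ((env_of N (map (skval N d (r n)) ts))(v := x)) p
      = sat N ((\<lambda>u. val (e u) n)(v := x)) p"
    "\<And>n. sat N (env_of N (map (skval N d (r n)) ts)) p = sat N (\<lambda>u. val (e u) n) p"
proof -
  obtain B where B: "\<And>v. v \<in> fv p \<Longrightarrow> v < B"
    using finite_fv[of p] finite_nat_set_iff_bounded by meson
  show thesis
    by (rule that[of "map (from_nat \<circ> e) [0..<B]"]; rule sat_cong)
      (auto simp: env_of_def val_def dest: B)
qed

text \<open>In the negation case \<open>decided\<close> does the work of ultrafilter maximality; in
  the existential case \<open>Wit\<close> supplies the witness.\<close>

theorem Los:
  "is_env pow e \<Longrightarrow>
    sat pow e p \<longleftrightarrow> (\<forall>\<^sub>F n in sequentially. sat N (\<lambda>v. val (e v) n) p)"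
proof (induction p arbitrary: e)
  case (Eq s t)
  have "sat pow e (Eq s t) \<longleftrightarrow>
      (\<forall>\<^sub>F n in sequentially. val (tval pow e s) n = val (tval pow e t) n)"
    using Eq tval_in_univ[OF wf_pow] by (simp add: eq_iff_val_eq)
  also have "\<dots> \<longleftrightarrow> (\<forall>\<^sub>F n in sequentially. sat N (\<lambda>v. val (e v) n) (Eq s t))"
    using eventually_conj[OF tval_pow[of e s] tval_pow[of e t]]
    by (intro eventually_subst) (auto elim: eventually_mono)
  finally show ?case .
next
  case (Less s t)
  have "sat pow e (Less s t) \<longleftrightarrow>
      (\<forall>\<^sub>F n in sequentially. s_less N (val (tval pow e s) n) (val (tval pow e t) n))"
    by (simp add: pow_def)
  also have "\<dots> \<longleftrightarrow> (\<forall>\<^sub>F n in sequentially. sat N (\<lambda>v. val (e v) n) (Less s t))"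
    using eventually_conj[OF tval_pow[of e s] tval_pow[of e t]]
    by (intro eventually_subst) (auto elim: eventually_mono)
  finally show ?case .
next
  case (Neg p)
  obtain ts :: "'k skolem list" where
    ts: "\<And>n. sat N (env_of N (map (skval N d (r n)) ts)) p = sat N (\<lambda>u. val (e u) n) p"
    using ex_skolem_list[of p e] by metis
  have "\<not> (\<forall>\<^sub>F n in sequentially. sat N (\<lambda>v. val (e v) n) p) \<longleftrightarrow>
      (\<forall>\<^sub>F n in sequentially. \<not> sat N (\<lambda>v. val (e v) n) p)"
  proof
    assume "\<not> (\<forall>\<^sub>F n in sequentially. sat N (\<lambda>v. val (e v) n) p)"
    then show "\<forall>\<^sub>F n in sequentially. \<not> sat N (\<lambda>v. val (e v) n) p"
      using decided[of ts p] unfolding ts by blast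
  next
    assume neg: "\<forall>\<^sub>F n in sequentially. \<not> sat N (\<lambda>v. val (e v) n) p"
    show "\<not> (\<forall>\<^sub>F n in sequentially. sat N (\<lambda>v. val (e v) n) p)"
    proof
      assume "\<forall>\<^sub>F n in sequentially. sat N (\<lambda>v. val (e v) n) p"
      with neg have "\<forall>\<^sub>F n :: nat in sequentially. False" by eventually_elim simp
      then show False by simp
    qed
  qed
  then show ?case using Neg by simp
next
  case (Conj p q)
  then show ?case by (simp add: eventually_conj_iff)
next
  case (Ex v p)
  have env: "is_env pow (e(v := a))" if "a \<in> univ pow" for a
    using that Ex.prems by (simp add: is_env_def)
  have IH: "sat pow (e(v := a)) p \<longleftrightarrow>
      (\<forall>\<^sub>F n in sequentially. sat N ((\<lambda>u. val (e u) n)(v := val a n)) p)" if "a \<in> univ pow" for a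
  proof -
    have upd: "(\<lambda>u. val ((e(v := a)) u) n) = (\<lambda>u. val (e u) n)(v := val a n)" for n
      by auto
    show ?thesis using Ex.IH[OF env[OF that]] unfolding upd .
  qed
  show ?case
  proof
    assume "sat pow e (Ex v p)"
    then obtain a where "a \<in> univ pow" "sat pow (e(v := a)) p" by auto
    then have "\<forall>\<^sub>F n in sequentially. sat N ((\<lambda>u. val (e u) n)(v := val a n)) p"
      using IH by blast
    then show "\<forall>\<^sub>F n in sequentially. sat N (\<lambda>v. val (e v) n) (Ex v p)"
      by eventually_elim (use val_in in auto)
  next
    assume ex: "\<forall>\<^sub>F n in sequentially. sat N (\<lambda>v. val (e v) n) (Ex v p)"
    obtain ts :: "'k skolem list" where
      ts: "\<And>n v x. sat N ((env_of N (map (skval N d (r n)) ts))(v := x)) p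
        = sat N ((\<lambda>u. val (e u) n)(v := x)) p"
      using ex_skolem_list[of p e] by metis
    \<comment> \<open>A single term names a witness in every coordinate that has one, so its class
      is a witness in \<open>pow\<close>.\<close>
    let ?a = "rep (Wit v p ts)"
    have a: "?a \<in> univ pow" by (simp add: pow_def)
    have "\<forall>\<^sub>F n in sequentially. sat N ((\<lambda>u. val (e u) n)(v := val ?a n)) p"
      using ex val_rep[of "Wit v p ts"]
    proof eventually_elim
      case (elim n)
      from elim(1) have "\<exists>x\<in>univ N. sat N ((env_of N (map (skval N d (r n)) ts))(v := x)) p"
        by (simp add: ts)
      then have "sat N ((env_of N (map (skval N d (r n)) ts))
          (v := skval N d (r n) (Wit v p ts))) p"
        using skval_Wit(2) wf by (metis wf_struct_def)
      then show ?case unfolding ts elim(2) .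
    qed
    then show "sat pow e (Ex v p)" using IH[OF a] a by auto
  qed
qed

lemma elem_equiv_pow: "elem_equiv pow N"
  unfolding elem_equiv_def
proof (intro allI impI)
  fix p e e'
  assume closed: "fv p = {}" and "is_env pow e"
  have "sat N (\<lambda>v. val (e v) n) p = sat N e' p" for n
    by (rule sat_cong) (simp add: closed)
  then show "sat pow e p \<longleftrightarrow> sat N e' p"
    using Los[OF \<open>is_env pow e\<close>] by simp
qed

lemma sat_pow_Cst:
  assumes "\<forall>\<^sub>F n in sequentially. sat N (\<lambda>v. d (f v) n) p"
  shows "sat pow (\<lambda>v. rep (Cst (f v))) p"
proof -
  have "\<forall>\<^sub>F n in sequentially. sat N (\<lambda>v. d (f v) (r n)) p"
    using eventually_subseq[OF mono_r assms] .
  moreover have "\<forall>\<^sub>F n in sequentially. \<forall>v\<in>fv p. val (rep (Cst (f v))) n = d (f v) (r n)"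
    \<comment> \<open>Finiteness of \<open>fv p\<close> matters: infinitely many eventual equalities
      need not eventually hold together.\<close>
    using finite_fv val_rep[of "Cst (f _)"] by (intro eventually_ball_finite) simp_all
  ultimately have "\<forall>\<^sub>F n in sequentially. sat N (\<lambda>v. val (rep (Cst (f v))) n) p"
  proof eventually_elim
    case (elim n)
    then show ?case
      using sat_cong[of p "\<lambda>v. val (rep (Cst (f v))) n" "\<lambda>v. d (f v) (r n)" N] by simp
  qed
  then show ?thesis by (subst Los) (simp_all add: is_env_def pow_def)
qed

end

text \<open>This does the work of compactness and downward Loewenheim-Skolem: configurations that
  appear in \<open>N\<close> only from some stage \<open>n\<close> on are realised together by the
  limits \<open>m k\<close>.\<close>

theorem ex_countable_limit_model:
  fixes d :: "'k::countable \<Rightarrow> nat \<Rightarrow> 'c"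
  assumes wf: "wf_struct N" and d: "\<And>k n. d k n \<in> univ N"
  obtains M :: "nat lstruct" and m :: "'k \<Rightarrow> nat"
  where "wf_struct M" "elem_equiv M N" "\<And>k. m k \<in> univ M"
    and "\<And>f p. \<forall>\<^sub>F n in sequentially. sat N (\<lambda>v. d (f v) n) p \<Longrightarrow> sat M (\<lambda>v. m (f v)) p"
proof -
  \<comment> \<open>The index \<open>k\<close> is a pair of a term list and a formula, hence of
    countable type.\<close>
  obtain r :: "nat \<Rightarrow> nat" where r: "strict_mono r"
    and dec: "\<And>k. (\<forall>\<^sub>F n in sequentially. sat N (env_of N (map (skval N d (r n)) (fst k))) (snd k)) \<or>
      (\<forall>\<^sub>F n in sequentially. \<not> sat N (env_of N (map (skval N d (r n)) (fst k))) (snd k))"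
    using ex_subseq_deciding[of "\<lambda>k n. sat N (env_of N (map (skval N d n) (fst k))) (snd k)"]
    by blast
  interpret reduced_power N d r
  proof
    show "(\<forall>\<^sub>F n in sequentially. sat N (env_of N (map (skval N d (r n)) ts)) p) \<or>
      (\<forall>\<^sub>F n in sequentially. \<not> sat N (env_of N (map (skval N d (r n)) ts)) p)" for ts p
      using dec[of "(ts, p)"] by simp
  qed (fact wf d r)+
  show thesis
    by (rule that[of pow "\<lambda>k. rep (Cst k)"])
      (simp_all add: wf_pow elem_equiv_pow sat_pow_Cst, simp add: pow_def)
qed

section \<open>Ordered fields\<close>

text \<open>The language has no constant \<open>1\<close>, so only positive powers are terms.\<close>
primrec pow_trm :: "nat \<Rightarrow> nat \<Rightarrow> trm" where
  "pow_trm v 0 = Var v"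
| "pow_trm v (Suc k) = Mul (Var v) (pow_trm v k)"

lemma tval_pow_trm: "tval ofield_struct e (pow_trm v k) = e v ^ Suc k"
  by (induction k) (auto simp: ofield_struct_def)

text \<open>The \<open>k - 1\<close> offsets the shift in \<open>pow_trm\<close>, so the exponent is
  right for \<open>k > 0\<close>.\<close>

definition is_pow_fm :: "nat \<Rightarrow> fm" where
  "is_pow_fm k = Ex 1 (Eq (pow_trm 1 (k - 1)) (Var 0))"

lemma sat_is_pow_fm:
  "k > 0 \<Longrightarrow> sat ofield_struct e (is_pow_fm k) \<longleftrightarrow> (\<exists>y. y ^ k = e 0)"
  by (simp add: is_pow_fm_def tval_pow_trm) (simp add: ofield_struct_def)

text \<open>The parameter-free \<open>\<phi>\<^sub>i\<close>: on the powers of \<open>g\<close>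
  considered below it reads off the exact power of \<open>m\<close> dividing the exponent.\<close>

definition exact_pow_fm :: "nat \<Rightarrow> nat \<Rightarrow> fm" where
  "exact_pow_fm m i = Conj (is_pow_fm (m ^ i)) (Neg (is_pow_fm (m ^ Suc i)))"

text \<open>The formula \<open>\<psi>(x; y)\<close>, where variables 1 and 2 form the tuple
  \<open>y\<close>.\<close>

definition between_fm :: fm where
  "between_fm = Conj (Less (Var 1) (Var 0)) (Less (Var 0) (Var 2))"

lemma sat_between_fm: "sat ofield_struct e between_fm \<longleftrightarrow> e 1 < e 0 \<and> e 0 < e 2"
  by (simp add: between_fm_def ofield_struct_def)

text \<open>As \<open>i < N\<close>, the factor \<open>g ^ (2 * j * m ^ N)\<close> is an
  \<open>m ^ Suc i\<close>-th power and can be divided out. Cancelling the exponent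
  \<open>m ^ i\<close> on nonnegative elements would then leave an \<open>m\<close>-th root of
  \<open>g\<close>; the absolute value covers negative \<open>y\<close>.\<close>

lemma no_root_exact_power:
  fixes g :: "'a::linordered_field"
  assumes g: "g > 0" and noroot: "\<nexists>y. y ^ m = g" and m: "m > 0" and i: "i < N"
  shows "\<nexists>y. y ^ (m ^ Suc i) = g ^ (2 * j * m ^ N + m ^ i)"
proof
  assume "\<exists>y. y ^ (m ^ Suc i) = g ^ (2 * j * m ^ N + m ^ i)"
  then obtain y where y: "y ^ (m ^ Suc i) = g ^ (2 * j * m ^ N + m ^ i)" ..
  let ?q = "g ^ (2 * j * m ^ (N - Suc i))"
  have q: "?q ^ (m ^ Suc i) = g ^ (2 * j * m ^ N)"
  proof -
    have "m ^ N = m ^ (N - Suc i) * m ^ Suc i"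
      using i by (simp del: power_Suc flip: power_add)
    then show ?thesis by (simp add: mult.assoc flip: power_mult)
  qed
  let ?z = "\<bar>y\<bar> / ?q"
  have "\<bar>y\<bar> ^ (m ^ Suc i) = g ^ (2 * j * m ^ N) * g ^ (m ^ i)"
    using g by (simp add: y power_add del: power_Suc flip: power_abs)
  then have "?z ^ (m ^ Suc i) = g ^ (m ^ i)"
    using g by (simp add: power_divide q del: power_Suc)
  then have "(?z ^ m) ^ (m ^ i) = g ^ (m ^ i)"
    by (simp flip: power_mult)
  then have "?z ^ m = g"
    by (rule power_eq_imp_eq_base) (use g m in auto)
  with noroot show False by blast
qed

text \<open>Being an \<open>m ^ k\<close>-th power gets stronger as \<open>k\<close> grows
  (\<open>down\<close>). It holds at \<open>k = i\<close>, since \<open>m ^ i\<close> divides the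
  exponent, and fails at \<open>Suc i\<close>; so \<open>i\<close> is the exact threshold.\<close>

lemma sat_exact_pow_fm:
  fixes g :: "'a::linordered_field"
  assumes g: "g > 0" and noroot: "\<nexists>y. y ^ m = g" and m: "m > 0" and i: "i < N"
    and e: "e 0 = g ^ (2 * j * m ^ N + m ^ i)"
  shows "sat ofield_struct e (exact_pow_fm m i') \<longleftrightarrow> i' = i"
proof -
  have down: "\<exists>y. y ^ (m ^ k) = x" if ex: "\<exists>y. y ^ (m ^ l) = x" and le: "k \<le> l" for x :: 'a and k l
  proof -
    obtain y where "y ^ (m ^ l) = x" using ex ..
    then have "(y ^ (m ^ (l - k))) ^ (m ^ k) = x"
      using le by (simp flip: power_mult power_add)
    then show ?thesis ..
  qed
  have no: "\<nexists>y. y ^ (m ^ Suc i) = e 0"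
    unfolding e by (rule no_root_exact_power) (use assms in auto)
  have "2 * j * m ^ N + m ^ i = (2 * j * m ^ (N - i) + 1) * m ^ i"
    using i by (simp add: algebra_simps flip: power_add)
  then have "(g ^ (2 * j * m ^ (N - i) + 1)) ^ (m ^ i) = e 0"
    by (simp only: e power_mult)
  then have yes: "\<exists>y. y ^ (m ^ i) = e 0" ..
  have "(\<exists>y. y ^ (m ^ k) = e 0) \<longleftrightarrow> k \<le> i" for k
    using down[OF yes, of k] down[of "k" "e 0" "Suc i"] no by (meson not_less_eq_eq)
  then show ?thesis
    using m by (auto simp: exact_pow_fm_def sat_is_pow_fm simp del: power_Suc)
qed

text \<open>Since \<open>g > 1\<close>, only exponents need comparing. The factor 2 gives intervals
  of length \<open>2 * ?M\<close>, so the offset \<open>?a\<close>, at most \<open>?M\<close>, stays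
  strictly inside.\<close>

lemma sat_between_fm_pow:
  fixes g :: "'a::linordered_field"
  assumes g: "g > 1" and m: "m > 0" and i: "i < N"
    and e: "e 0 = g ^ (2 * j * m ^ N + m ^ i)"
      "e 1 = g ^ (2 * j' * m ^ N)" "e 2 = g ^ (2 * Suc j' * m ^ N)"
  shows "sat ofield_struct e between_fm \<longleftrightarrow> j' = j"
proof -
  let ?M = "m ^ N" and ?a = "m ^ i"
  have a: "0 < ?a" "?a \<le> ?M"
    using m i by (auto intro: power_increasing)
  have "2 * j' * ?M < 2 * j * ?M + ?a \<and> 2 * j * ?M + ?a < 2 * Suc j' * ?M \<longleftrightarrow> j' = j"
  proof
    assume *: "2 * j' * ?M < 2 * j * ?M + ?a \<and> 2 * j * ?M + ?a < 2 * Suc j' * ?M"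
    have "2 * j' * ?M < 2 * Suc j * ?M" "2 * j * ?M < 2 * Suc j' * ?M"
      using * a by (auto simp: algebra_simps)
    then have "2 * j' < 2 * Suc j" "2 * j < 2 * Suc j'"
      by (simp_all only: mult_less_cancel2)
    then show "j' = j" by simp
  next
    show "2 * j' * ?M < 2 * j * ?M + ?a \<and> 2 * j * ?M + ?a < 2 * Suc j' * ?M" if "j' = j"
      unfolding that mult_Suc_right distrib_right using a by linarith
  qed
  then show ?thesis
    using g by (simp only: sat_between_fm e power_strict_increasing_iff)
qed

section \<open>Failure of dp-smallness without roots\<close>

lemma not_dp_small:
  fixes g :: "'a::linordered_field"
  assumes g: "g > 1" and noroot: "\<nexists>y. y ^ m = g" and m: "m > 0"
  shows "\<not> dp_small_theory (ofield_struct :: 'a lstruct)"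
proof -
  let ?N = "ofield_struct :: 'a lstruct"
  text \<open>The index \<open>(0, j)\<close> stands for the parameter \<open>b\<^sub>j\<close>, and \<open>(Suc i, j)\<close> for the realisation of
    \<open>\<phi>\<^sub>i\<close> in the \<open>j\<close>-th interval.\<close>
  define d :: "nat \<times> nat \<Rightarrow> nat \<Rightarrow> 'a" where
    "d = (\<lambda>(k, j) n. g ^ (2 * j * m ^ n + (case k of 0 \<Rightarrow> 0 | Suc i \<Rightarrow> m ^ i)))"
  have wf_N: "wf_struct ?N" and d_in: "\<And>k n. d k n \<in> univ ?N"
    by (simp_all add: wf_struct_def ofield_struct_def)
  obtain M :: "nat lstruct" and c where wf: "wf_struct M" and equiv: "elem_equiv M ?N"
    and c_in: "\<And>k. c k \<in> univ M"
    and transfer: "\<And>f p. \<forall>\<^sub>F n in sequentially. sat ?N (\<lambda>v. d (f v) n) p \<Longrightarrow> sat M (\<lambda>v. c (f v)) p"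
    by (rule ex_countable_limit_model[of ?N d, OF wf_N d_in]) blast
  \<comment> \<open>Variables 1 and 2 receive the endpoints with indices \<open>j\<close> and
    \<open>Suc j\<close>; variable 0 will be overwritten.\<close>
  define b where "b j v = (0 :: nat, if v = 2 then Suc j else j)" for j and v :: nat
  \<comment> \<open>The pair \<open>(0, 0)\<close> is a dummy default for variables other than 0.
    The threshold \<open>n > i0\<close> does not depend on \<open>i\<close>.\<close>
  have exact: "sat ?N (\<lambda>v. d (((\<lambda>_. (0, 0))(0 := (Suc i0, j0))) v) n) (exact_pow_fm m i) \<longleftrightarrow> i = i0"
    if "n > i0" for n i i0 j0
    by (rule sat_exact_pow_fm[OF _ noroot m that]) (use g in \<open>auto simp: d_def\<close>)
  have between: "sat ?N (\<lambda>v. d (((b j)(0 := (Suc i0, j0))) v) n) between_fm \<longleftrightarrow> j = j0"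
    if "n > i0" for n i0 j j0
    by (rule sat_between_fm_pow[OF g m that]) (auto simp: d_def b_def)
  have "sat M ((\<lambda>v. c (0, 0))(0 := c (Suc i0, j0))) (exact_pow_fm m i) \<longleftrightarrow> i = i0" for i i0 j0
  proof -
    \<comment> \<open>\<open>transfer\<close> preserves truth only, so the falsity for
      \<open>i \<noteq> i0\<close> is carried over as truth of the negated formula.\<close>
    have "\<forall>\<^sub>F n in sequentially. sat ?N (\<lambda>v. d (((\<lambda>_. (0, 0))(0 := (Suc i0, j0))) v) n)
        (if i = i0 then exact_pow_fm m i else Neg (exact_pow_fm m i))"
      using eventually_gt_at_top[of i0] by eventually_elim (use exact in auto)
    from transfer[OF this]
    have "sat M (\<lambda>v. c (((\<lambda>_. (0, 0))(0 := (Suc i0, j0))) v)) (exact_pow_fm m i) \<longleftrightarrow> i = i0"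
      by (auto split: if_splits)
    moreover have "(\<lambda>v. c (((\<lambda>_. (0, 0))(0 := (Suc i0, j0))) v))
        = (\<lambda>v. c (0, 0))(0 := c (Suc i0, j0))"
      by auto
    ultimately show ?thesis by metis
  qed
  moreover have "sat M ((\<lambda>v. c (b j v))(0 := c (Suc i0, j0))) between_fm \<longleftrightarrow> j = j0" for i0 j j0
  proof -
    have "\<forall>\<^sub>F n in sequentially. sat ?N (\<lambda>v. d (((b j)(0 := (Suc i0, j0))) v) n)
        (if j = j0 then between_fm else Neg between_fm)"
      using eventually_gt_at_top[of i0] by eventually_elim (use between in auto)
    from transfer[OF this]
    have "sat M (\<lambda>v. c (((b j)(0 := (Suc i0, j0))) v)) between_fm \<longleftrightarrow> j = j0"
      by (auto split: if_splits)
    moreover have "(\<lambda>v. c (((b j)(0 := (Suc i0, j0))) v)) = (\<lambda>v. c (b j v))(0 := c (Suc i0, j0))"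
      by auto
    ultimately show ?thesis by metis
  qed
  \<comment> \<open>The realisation for \<open>(i0, j0)\<close> is the limit element
    \<open>c (Suc i0, j0)\<close>.\<close>
  ultimately have "\<forall>i0 j0. \<exists>a\<in>univ M.
      sat M ((\<lambda>v. c (0, 0))(0 := a)) (exact_pow_fm m i0) \<and>
      sat M ((\<lambda>v. c (b j0 v))(0 := a)) between_fm \<and>
      (\<forall>i. i \<noteq> i0 \<longrightarrow> \<not> sat M ((\<lambda>v. c (0, 0))(0 := a)) (exact_pow_fm m i)) \<and>
      (\<forall>j. j \<noteq> j0 \<longrightarrow> \<not> sat M ((\<lambda>v. c (b j v))(0 := a)) between_fm)"
    using c_in by blast
  moreover have "\<forall>i. is_env M (\<lambda>v. c (0, 0))" "\<forall>j. is_env M (\<lambda>v. c (b j v))"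
    using c_in by (simp_all add: is_env_def)
  ultimately show ?thesis
    unfolding dp_small_theory_def not_not
    using wf equiv
    by (intro exI[of _ M] exI[of _ "exact_pow_fm m"] exI[of _ "\<lambda>i v. c (0, 0)"]
        exI[of _ between_fm] exI[of _ "\<lambda>j v. c (b j v)"] conjI) assumption+
qed

theorem theorem1p6:
  assumes "dp_small_theory (ofield_struct :: 'a::linordered_field lstruct)"
  shows "\<forall>(x::'a) > 0. \<forall>n::nat. n > 0 \<longrightarrow> (\<exists>y::'a. y ^ n = x)"
proof (intro allI impI)
  fix x :: 'a and n :: nat
  assume x: "x > 0" and n: "n > 0"
  \<comment> \<open>Elements above 1 come first; those below 1 follow by inversion.\<close>
  have root: "\<exists>y. y ^ n = z" if "z > 1" for z :: 'a
    using not_dp_small[OF that _ n] assms by blast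
  consider "x > 1" | "x = 1" | "x < 1" by (rule linorder_cases)
  then show "\<exists>y. y ^ n = x"
  proof cases
    case 1
    then show ?thesis by (rule root)
  next
    case 2
    then show ?thesis using power_one by blast
  next
    case 3
    with x have "inverse x > 1" by (simp add: one_less_inverse)
    then obtain y where "y ^ n = inverse x" using root by blast
    then have "inverse y ^ n = x" by (simp add: power_inverse)
    then show ?thesis ..
  qed
qed

end
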